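(* Set $\hbar=1$. Let $\beta>0$ and consider the thermal state of a fixed quadratic Hamiltonian with normal-mode frequencies $\omega_1,\dots,\omega_N>0$, so that the symplectic eigenvalues are $\nu_k=\frac12\coth\frac{\beta\omega_k}{2}$. Including the zero-point energy, the partition function is $Z=\prod_{k}\frac{1}{2\sinh(\beta\omega_k/2)}$. Then the function $\Phi=-\frac12\sum_{k=1}^N\log\left(\nu_k^2-\frac14\right)$ satisfies $$\Phi=\sum_{k=1}^N\log\left[2\sinh\left(\frac{\beta\omega_k}{2}\right)\right]=-\log Z=\beta F .$$
   Context: $F=-\beta^{-1}\log Z$ is the Helmholtz free energy; logarithms are natural. The vacuum covariance is $\frac12\mathbb 1$, so symplectic eigenvalues of faithful states satisfy $\nu_k>1/2$. *)

theory Defs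
  imports "HOL-Analysis.Analysis"
begin

text \<open>
  Units with hbar = 1. Phase space of N = CARD('n) modes is indexed by the sum type 'n + 'n:
  \<open>Inl k\<close> is the position and \<open>Inr k\<close> the momentum of mode \<open>k\<close>.
\<close>

type_synonym 'n phase_matrix = "real ^ ('n + 'n) ^ ('n + 'n)"

definition symplectic_form :: "('n::finite) phase_matrix" where
  "symplectic_form = (\<chi> i j. case (i, j) of
      (Inl k, Inr l) \<Rightarrow> if k = l then 1 else 0
    | (Inr k, Inl l) \<Rightarrow> if k = l then - 1 else 0
    | _ \<Rightarrow> 0)"

definition symplectic :: "('n::finite) phase_matrix \<Rightarrow> bool" where
  "symplectic S \<longleftrightarrow> S ** symplectic_form ** transpose S = symplectic_form"

definition mode_diag :: "('n::finite \<Rightarrow> real) \<Rightarrow> 'n phase_matrix" where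
  "mode_diag d = (\<chi> i j. if i = j then d (case_sum id id i) else 0)"

text \<open>Williamson normal form; it determines \<open>\<nu>\<close> up to a permutation of the modes.\<close>

definition symplectic_eigenvalues :: "('n::finite) phase_matrix \<Rightarrow> ('n \<Rightarrow> real) \<Rightarrow> bool" where
  "symplectic_eigenvalues V \<nu> \<longleftrightarrow> (\<forall>k. \<nu> k > 0) \<and>
     (\<exists>T. symplectic T \<and> T ** V ** transpose T = mode_diag \<nu>)"

text \<open>
  \<open>S\<close> expresses the canonical operators R through normal-mode operators X, R = S X, and thereby
  brings the quadratic form (1/2) R^T h R into (1/2) sum_k \<omega>_k (q_k^2 + p_k^2).
\<close>

definition normal_modes ::
    "('n::finite) phase_matrix \<Rightarrow> 'n phase_matrix \<Rightarrow> ('n \<Rightarrow> real) \<Rightarrow> bool" where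
  "normal_modes h S \<omega> \<longleftrightarrow> symplectic S \<and> transpose S ** h ** S = mode_diag \<omega>"

text \<open>
  Bosonic Fock space of the normal modes in the occupation number representation. A wave function
  assigns an amplitude to each occupation vector. The operators below are polynomials in the
  ladder operators; their formulas make sense on all wave functions, so no domains are carried
  along, and only matrix elements between number states are used.
\<close>

type_synonym 'n occupation = "'n \<Rightarrow> nat"
type_synonym 'n wavefun = "'n occupation \<Rightarrow> complex"
type_synonym 'n fock_op = "'n wavefun \<Rightarrow> 'n wavefun"
type_synonym 'n fock_matrix = "'n occupation \<Rightarrow> 'n occupation \<Rightarrow> complex"

definition ket :: "'n occupation \<Rightarrow> 'n wavefun" where
  "ket n = (\<lambda>m. if m = n then 1 else 0)"

definition matrix_element :: "'n fock_op \<Rightarrow> 'n fock_matrix" where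
  "matrix_element A m n = A (ket n) m"

definition annihilation :: "'n \<Rightarrow> 'n fock_op" where
  "annihilation k \<psi> = (\<lambda>m. of_real (sqrt (real (m k + 1))) * \<psi> (m(k := m k + 1)))"

text \<open>For \<open>m k = 0\<close> the factor vanishes, so the truncated subtraction is harmless.\<close>

definition creation :: "'n \<Rightarrow> 'n fock_op" where
  "creation k \<psi> = (\<lambda>m. of_real (sqrt (real (m k))) * \<psi> (m(k := m k - 1)))"

text \<open>
  With q = (a + a*) / sqrt 2 and p = (a - a*) / (i sqrt 2) one has [q, p] = i, and the vacuum
  covariance matrix is one half of the identity.
\<close>

definition normal_quadrature :: "'n + 'n \<Rightarrow> 'n fock_op" where
  "normal_quadrature i \<psi> = (case i of
      Inl k \<Rightarrow> (\<lambda>m. (annihilation k \<psi> m + creation k \<psi> m) / of_real (sqrt 2))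
    | Inr k \<Rightarrow> (\<lambda>m. (annihilation k \<psi> m - creation k \<psi> m) / (\<i> * of_real (sqrt 2))))"

definition quadrature :: "('n::finite) phase_matrix \<Rightarrow> 'n + 'n \<Rightarrow> 'n fock_op" where
  "quadrature S i \<psi> = (\<lambda>m. \<Sum>j\<in>UNIV. of_real (S $ i $ j) * normal_quadrature j \<psi> m)"

definition hamiltonian :: "('n::finite) phase_matrix \<Rightarrow> 'n phase_matrix \<Rightarrow> 'n fock_op" where
  "hamiltonian h S \<psi> = (\<lambda>m. (\<Sum>i\<in>UNIV. \<Sum>j\<in>UNIV.
      of_real (h $ i $ j) * quadrature S i (quadrature S j \<psi>) m) / 2)"

text \<open>Matrix elements of exp(-\<open>\<beta>\<close> H) between number states, by the exponential series.\<close>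

definition gibbs_matrix :: "real \<Rightarrow> 'n fock_op \<Rightarrow> 'n fock_matrix" where
  "gibbs_matrix \<beta> H m n =
     (\<Sum>j. of_real ((- \<beta>) ^ j / fact j) * matrix_element (H ^^ j) m n)"

definition fock_trace :: "'n fock_matrix \<Rightarrow> complex" where
  "fock_trace A = (\<Sum>\<^sub>\<infinity>n. A n n)"

text \<open>The trace of the self-adjoint operator exp(-\<open>\<beta>\<close> H) is real.\<close>

definition partition_function :: "real \<Rightarrow> 'n fock_op \<Rightarrow> real" where
  "partition_function \<beta> H = Re (fock_trace (gibbs_matrix \<beta> H))"

definition free_energy :: "real \<Rightarrow> 'n fock_op \<Rightarrow> real" where
  "free_energy \<beta> H = - (1 / \<beta>) * ln (partition_function \<beta> H)"

definition thermal_state :: "real \<Rightarrow> 'n fock_op \<Rightarrow> 'n fock_matrix" where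
  "thermal_state \<beta> H m n = gibbs_matrix \<beta> H m n / of_real (partition_function \<beta> H)"

definition expectation :: "'n fock_matrix \<Rightarrow> 'n fock_op \<Rightarrow> complex" where
  "expectation \<rho> A = fock_trace (\<lambda>m n. \<Sum>\<^sub>\<infinity>l. \<rho> m l * matrix_element A l n)"

definition covariance_matrix ::
    "('n::finite) fock_matrix \<Rightarrow> ('n + 'n \<Rightarrow> 'n fock_op) \<Rightarrow> 'n phase_matrix" where
  "covariance_matrix \<rho> R = (\<chi> i j. Re (
      expectation \<rho> (\<lambda>\<psi> m. (R i (R j \<psi>) m + R j (R i \<psi>) m) / 2)
      - expectation \<rho> (R i) * expectation \<rho> (R j)))"

definition coth :: "real \<Rightarrow> real" where
  "coth x = cosh x / sinh x"

definition Phi :: "('n::finite \<Rightarrow> real) \<Rightarrow> real" where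
  "Phi \<nu> = - (1 / 2) * (\<Sum>k\<in>UNIV. ln ((\<nu> k)\<^sup>2 - 1 / 4))"

end

theory Submission
  imports Defs
begin

text \<open>
  In the normal-mode quadratures X the Hamiltonian is (1/2) sum_k \<open>\<omega>\<^sub>k (q\<^sub>k\<^sup>2 + p\<^sub>k\<^sup>2)\<close>, hence diagonal in
  the number basis with eigenvalue sum_k \<open>\<omega>\<^sub>k (m\<^sub>k + 1/2)\<close>. All traces therefore factor over the modes
  into geometric series and their derivatives. On diagonal matrix elements the symmetrized products
  of different quadratures vanish, so that X has covariance matrix diag(\<open>\<nu>\<close>) and S X has covariance
  matrix \<open>S diag(\<nu>) S\<^sup>T\<close>; the inverse of S brings it to Williamson form. The formula for \<open>\<Phi>\<close> is
  \<open>coth\<^sup>2 - 1 = 1 / sinh\<^sup>2\<close>.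
\<close>

section \<open>Ladder operators and quadratures\<close>

text \<open>A diagonal element survives only if the product restores every occupation number. Equal
  types shift the total by two, and mixed types in different modes move a quantum from one mode to
  another.\<close>

lemma ket_diag_ladder:
  "annihilation k (annihilation l (ket m)) m = 0"
  "creation k (creation l (ket m)) m = 0"
  "annihilation k (creation l (ket m)) m = (if k = l then of_nat (m k) + 1 else 0)"
  "creation k (annihilation l (ket m)) m = (if k = l then of_nat (m k) else 0)"
proof -
  have sq: "complex_of_real (sqrt x) * complex_of_real (sqrt x) = complex_of_real x"
    if "x \<ge> 0" for x
    using that by (metis of_real_mult real_sqrt_mult_self abs_of_nonneg)
  have "(m(k := m k + 1)) (l := (m(k := m k + 1)) l + 1) \<noteq> m"
    by (metis fun_upd_apply less_add_one less_irrefl add_lessD1)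
  then show "annihilation k (annihilation l (ket m)) m = 0"
    by (simp add: annihilation_def ket_def)
  \<comment> \<open>For \<open>m k = 0\<close> truncated subtraction may leave \<open>m\<close>
    unchanged; there the factor \<open>sqrt (m k)\<close> vanishes instead.\<close>
  have "(m(k := m k - 1)) (l := (m(k := m k - 1)) l - 1) \<noteq> m" if "m k \<noteq> 0"
  proof
    assume "(m(k := m k - 1)) (l := (m(k := m k - 1)) l - 1) = m"
    from fun_cong[OF this, of k] that show False
      by (auto split: if_splits)
  qed
  then show "creation k (creation l (ket m)) m = 0"
    by (cases "m k = 0") (simp_all add: creation_def ket_def)
  show "annihilation k (creation l (ket m)) m = (if k = l then of_nat (m k) + 1 else 0)"
  proof (cases "k = l")
    case True
    then show ?thesis
      using sq[of "1 + real (m l)"] by (simp add: annihilation_def creation_def ket_def)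
  next
    case False
    have "(m(k := m k + 1)) (l := (m(k := m k + 1)) l - 1) \<noteq> m"
    proof
      assume "(m(k := m k + 1)) (l := (m(k := m k + 1)) l - 1) = m"
      from fun_cong[OF this, of k] False show False by auto
    qed
    with False show ?thesis by (simp add: annihilation_def creation_def ket_def)
  qed
  show "creation k (annihilation l (ket m)) m = (if k = l then of_nat (m k) else 0)"
  proof (cases "k = l")
    case True
    then show ?thesis
      using sq[of "real (m l)"] by (cases "m l") (auto simp: annihilation_def creation_def ket_def)
  next
    case False
    have "(m(k := m k - 1)) (l := (m(k := m k - 1)) l + 1) \<noteq> m"
    proof
      assume "(m(k := m k - 1)) (l := (m(k := m k - 1)) l + 1) = m"
      \<comment> \<open>The comparison is made at \<open>l\<close>, where the number is raised; at
        \<open>k\<close> it would fail for \<open>m k = 0\<close>.\<close>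
      from fun_cong[OF this, of l] False show False by auto
    qed
    with False show ?thesis by (simp add: annihilation_def creation_def ket_def)
  qed
qed

text \<open>The type \<open>fock_op\<close> admits arbitrary maps, so linearity must be derived
  before products of quadratures can be expanded.\<close>

lemma normal_quadrature_sum:
  "normal_quadrature i (\<lambda>m. \<Sum>j\<in>A. c j * \<phi> j m) m = (\<Sum>j\<in>A. c j * normal_quadrature i (\<phi> j) m)"
proof -
  have a: "annihilation k (\<lambda>m. \<Sum>j\<in>A. c j * \<phi> j m) m = (\<Sum>j\<in>A. c j * annihilation k (\<phi> j) m)" for k
    by (simp add: annihilation_def sum_distrib_left mult_ac)
  have c: "creation k (\<lambda>m. \<Sum>j\<in>A. c j * \<phi> j m) m = (\<Sum>j\<in>A. c j * creation k (\<phi> j) m)" for k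
    by (simp add: creation_def sum_distrib_left mult_ac)
  show ?thesis
    by (cases i)
      (simp_all add: normal_quadrature_def a c sum_divide_distrib ring_distribs add_divide_distrib
        diff_divide_distrib sum.distrib sum_subtractf)
qed

lemma quadrature_quadrature:
  "quadrature S i (quadrature S j \<psi>) m =
     (\<Sum>a\<in>UNIV. \<Sum>b\<in>UNIV. of_real (S $ i $ a * S $ j $ b) *
        normal_quadrature a (normal_quadrature b \<psi>) m)"
proof -
  have "quadrature S j \<psi> = (\<lambda>m. \<Sum>b\<in>UNIV. of_real (S $ j $ b) * normal_quadrature b \<psi> m)"
    by (simp add: quadrature_def)
  then show ?thesis
    by (simp add: quadrature_def[of S i] normal_quadrature_sum sum_distrib_left mult.assoc)
qed

text \<open>The order of the factors is kept, since ladder operators of one mode do not commute. A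
  general \<open>\<psi>\<close> serves both the Hamiltonian and the second moments.\<close>

lemma normal_quadrature_expand:
  "normal_quadrature (Inl k) (normal_quadrature (Inl l) \<psi>) m =
     (annihilation k (annihilation l \<psi>) m + annihilation k (creation l \<psi>) m +
      creation k (annihilation l \<psi>) m + creation k (creation l \<psi>) m) / 2"
  "normal_quadrature (Inr k) (normal_quadrature (Inr l) \<psi>) m =
     (- annihilation k (annihilation l \<psi>) m + annihilation k (creation l \<psi>) m +
      creation k (annihilation l \<psi>) m - creation k (creation l \<psi>) m) / 2"
  "normal_quadrature (Inl k) (normal_quadrature (Inr l) \<psi>) m =
     (annihilation k (annihilation l \<psi>) m - annihilation k (creation l \<psi>) m +
      creation k (annihilation l \<psi>) m - creation k (creation l \<psi>) m) / (2 * \<i>)"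
  "normal_quadrature (Inr k) (normal_quadrature (Inl l) \<psi>) m =
     (annihilation k (annihilation l \<psi>) m + annihilation k (creation l \<psi>) m -
      creation k (annihilation l \<psi>) m - creation k (creation l \<psi>) m) / (2 * \<i>)"
proof -
  have two: "complex_of_real (sqrt 2) * complex_of_real (sqrt 2) = 2"
    by (metis of_real_mult of_real_numeral real_sqrt_mult_self abs_numeral)
  have a1: "annihilation k (\<lambda>m. (f m + g m) / c) m = (annihilation k f m + annihilation k g m) / c"
    "annihilation k (\<lambda>m. (f m - g m) / c) m = (annihilation k f m - annihilation k g m) / c" for f g c
    by (simp_all add: annihilation_def ring_distribs)
  have c1: "creation k (\<lambda>m. (f m + g m) / c) m = (creation k f m + creation k g m) / c"
    "creation k (\<lambda>m. (f m - g m) / c) m = (creation k f m - creation k g m) / c" for f g c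
    by (simp_all add: creation_def ring_distribs)
  have q: "normal_quadrature (Inl k) \<psi> = (\<lambda>m. (annihilation k \<psi> m + creation k \<psi> m) / of_real (sqrt 2))"
    "normal_quadrature (Inr k) \<psi> = (\<lambda>m. (annihilation k \<psi> m - creation k \<psi> m) / (\<i> * of_real (sqrt 2)))"
    for k and \<psi> :: "'a wavefun"
    by (simp_all add: normal_quadrature_def)
  have d: "(x / y + x' / y) / z = (x + x') / (y * z)" "(x / y - x' / y) / z = (x - x') / (y * z)"
    for x x' y z :: complex
    by (simp_all add: add_divide_distrib diff_divide_distrib)
  have p: "complex_of_real (sqrt 2) * (\<i> * complex_of_real (sqrt 2)) = 2 * \<i>"
    "\<i> * complex_of_real (sqrt 2) * complex_of_real (sqrt 2) = 2 * \<i>"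
    "\<i> * complex_of_real (sqrt 2) * (\<i> * complex_of_real (sqrt 2)) = - 2"
    using two by (simp_all add: mult_ac)
  show "normal_quadrature (Inl k) (normal_quadrature (Inl l) \<psi>) m =
     (annihilation k (annihilation l \<psi>) m + annihilation k (creation l \<psi>) m +
      creation k (annihilation l \<psi>) m + creation k (creation l \<psi>) m) / 2"
    unfolding q a1 c1 d two by (simp add: field_simps)
  show "normal_quadrature (Inr k) (normal_quadrature (Inr l) \<psi>) m =
     (- annihilation k (annihilation l \<psi>) m + annihilation k (creation l \<psi>) m +
      creation k (annihilation l \<psi>) m - creation k (creation l \<psi>) m) / 2"
    unfolding q a1 c1 d p by (simp add: field_simps)
  show "normal_quadrature (Inl k) (normal_quadrature (Inr l) \<psi>) m =
     (annihilation k (annihilation l \<psi>) m - annihilation k (creation l \<psi>) m +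
      creation k (annihilation l \<psi>) m - creation k (creation l \<psi>) m) / (2 * \<i>)"
    unfolding q a1 c1 d p by (simp add: field_simps)
  show "normal_quadrature (Inr k) (normal_quadrature (Inl l) \<psi>) m =
     (annihilation k (annihilation l \<psi>) m + annihilation k (creation l \<psi>) m -
      creation k (annihilation l \<psi>) m - creation k (creation l \<psi>) m) / (2 * \<i>)"
    unfolding q a1 c1 d p by (simp add: field_simps)
qed

text \<open>Symmetrizing removes the commutator: the diagonal elements of q p and p q in one mode
  are opposite, while q q and p p each contribute n + 1/2.\<close>

lemma normal_quadrature_diag_sym:
  "normal_quadrature a (normal_quadrature b (ket m)) m + normal_quadrature b (normal_quadrature a (ket m)) m
     = (if a = b then of_real (2 * real (m (case_sum id id a)) + 1) else 0)"
  by (cases a; cases b) (simp_all add: normal_quadrature_expand ket_diag_ladder field_simps)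

text \<open>A single ladder operator changes an occupation number, so first moments vanish in any
  state diagonal in the number basis.\<close>

lemma normal_quadrature_diag: "normal_quadrature a (ket m) m = 0"
proof -
  have "annihilation k (ket m) m = 0" for k
    by (auto simp: annihilation_def ket_def fun_eq_iff intro!: exI[of _ k])
  moreover have "creation k (ket m) m = 0" for k
    by (cases "m k") (auto simp: creation_def ket_def fun_eq_iff intro!: exI[of _ k])
  ultimately show ?thesis
    by (simp add: normal_quadrature_def split: sum.splits)
qed

text \<open>Stated for arbitrary wave functions, not only kets, so that the Hamiltonian becomes a
  multiplication operator whose powers are immediate.\<close>

lemma ladder_products:
  "annihilation k (creation k \<psi>) m = (of_nat (m k) + 1) * \<psi> m"
  "creation k (annihilation k \<psi>) m = of_nat (m k) * \<psi> m"
proof -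
  have sq: "complex_of_real (sqrt x) * (complex_of_real (sqrt x) * y) = complex_of_real x * y"
    if "x \<ge> 0" for x y
    using that by (metis of_real_mult real_sqrt_mult_self abs_of_nonneg mult.assoc)
  show "annihilation k (creation k \<psi>) m = (of_nat (m k) + 1) * \<psi> m"
    using sq[of "1 + real (m k)"] by (simp add: annihilation_def creation_def add.commute)
  show "creation k (annihilation k \<psi>) m = of_nat (m k) * \<psi> m"
    using sq[of "real (m k)" "\<psi> m"]
    by (cases "m k") (simp_all add: annihilation_def creation_def fun_upd_idem)
qed

section \<open>The Hamiltonian in normal modes\<close>

definition energy :: "('n::finite \<Rightarrow> real) \<Rightarrow> 'n occupation \<Rightarrow> real" where
  "energy \<omega> m = (\<Sum>k\<in>UNIV. \<omega> k * (real (m k) + 1 / 2))"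

lemma sum_UNIV_Plus:
  "(\<Sum>a\<in>(UNIV :: ('a::finite + 'b::finite) set). f a) = (\<Sum>k\<in>UNIV. f (Inl k)) + (\<Sum>k\<in>UNIV. f (Inr k))"
  using sum.Plus[of "UNIV :: 'a set" "UNIV :: 'b set" f] by simp

text \<open>Substituting R = S X replaces \<open>h\<close> by \<open>transpose S ** h ** S\<close>,
  which is diagonal; each mode is then left with a multiple of its number operator plus the
  zero-point term.\<close>

lemma hamiltonian_eq_energy:
  assumes "normal_modes h S \<omega>"
  shows "hamiltonian h S \<psi> m = of_real (energy \<omega> m) * \<psi> m"
proof -
  define M where "M a b = normal_quadrature a (normal_quadrature b \<psi>) m" for a b
  have diag: "(\<Sum>i\<in>UNIV. \<Sum>j\<in>UNIV. S $ i $ a * h $ i $ j * S $ j $ b)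
      = (if a = b then \<omega> (case_sum id id a) else 0)" for a b
  proof -
    have "(transpose S ** h ** S) $ a $ b = (\<Sum>j\<in>UNIV. \<Sum>i\<in>UNIV. S $ i $ a * h $ i $ j * S $ j $ b)"
      by (simp add: matrix_matrix_mult_def transpose_def sum_distrib_right)
    also have "\<dots> = (\<Sum>i\<in>UNIV. \<Sum>j\<in>UNIV. S $ i $ a * h $ i $ j * S $ j $ b)"
      by (rule sum.swap)
    finally show ?thesis
      using assms by (simp add: normal_modes_def mode_diag_def)
  qed
  have "2 * hamiltonian h S \<psi> m = (\<Sum>i\<in>UNIV. \<Sum>j\<in>UNIV. \<Sum>a\<in>UNIV. \<Sum>b\<in>UNIV.
      of_real (S $ i $ a * h $ i $ j * S $ j $ b) * M a b)"
    by (simp add: hamiltonian_def quadrature_quadrature M_def sum_distrib_left mult_ac)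
  \<comment> \<open>The sums over \<open>i\<close> and \<open>j\<close> move innermost, where they
    assemble the entries computed in \<open>diag\<close>.\<close>
  also have "\<dots> = (\<Sum>i\<in>UNIV. \<Sum>a\<in>UNIV. \<Sum>j\<in>UNIV. \<Sum>b\<in>UNIV.
      of_real (S $ i $ a * h $ i $ j * S $ j $ b) * M a b)"
    by (intro sum.cong refl sum.swap)
  also have "\<dots> = (\<Sum>a\<in>UNIV. \<Sum>i\<in>UNIV. \<Sum>b\<in>UNIV. \<Sum>j\<in>UNIV.
      of_real (S $ i $ a * h $ i $ j * S $ j $ b) * M a b)"
    by (subst sum.swap) (intro sum.cong refl sum.swap)
  also have "\<dots> = (\<Sum>a\<in>UNIV. \<Sum>b\<in>UNIV. \<Sum>i\<in>UNIV. \<Sum>j\<in>UNIV.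
      of_real (S $ i $ a * h $ i $ j * S $ j $ b) * M a b)"
    by (intro sum.cong refl sum.swap)
  also have "\<dots> = (\<Sum>a\<in>UNIV. \<Sum>b\<in>UNIV.
      of_real (\<Sum>i\<in>UNIV. \<Sum>j\<in>UNIV. S $ i $ a * h $ i $ j * S $ j $ b) * M a b)"
    by (simp add: sum_distrib_right)
  also have "\<dots> = (\<Sum>a\<in>UNIV. of_real (\<omega> (case_sum id id a)) * M a a)"
    unfolding diag by (simp add: if_distrib if_distribR cong: if_cong)
  also have "\<dots> = (\<Sum>k\<in>UNIV. of_real (\<omega> k) * (M (Inl k) (Inl k) + M (Inr k) (Inr k)))"
    by (simp add: sum_UNIV_Plus sum.distrib ring_distribs)
  also have "\<dots> = (\<Sum>k\<in>UNIV. of_real (\<omega> k) * ((2 * of_nat (m k) + 1) * \<psi> m))"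
  proof (intro sum.cong refl)
    fix k
    \<comment> \<open>The squares of the ladder operators cancel between q q and p p.\<close>
    have "M (Inl k) (Inl k) + M (Inr k) (Inr k) = (2 * of_nat (m k) + 1) * \<psi> m"
      by (simp add: M_def normal_quadrature_expand ladder_products field_simps)
    then show "of_real (\<omega> k) * (M (Inl k) (Inl k) + M (Inr k) (Inr k))
        = of_real (\<omega> k) * ((2 * of_nat (m k) + 1) * \<psi> m)"
      by simp
  qed
  also have "\<dots> = 2 * (of_real (energy \<omega> m) * \<psi> m)"
    by (simp add: energy_def sum_distrib_left sum_distrib_right)
      (intro sum.cong refl, simp add: field_simps)
  finally show ?thesis by simp
qed

text \<open>Powers of a multiplication operator multiply by powers of the energy, which leaves the
  scalar exponential series.\<close>

lemma gibbs_matrix_eq: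
  assumes "normal_modes h S \<omega>"
  shows "gibbs_matrix \<beta> (hamiltonian h S) m n = (if m = n then of_real (exp (- \<beta> * energy \<omega> m)) else 0)"
proof -
  have pow: "(hamiltonian h S ^^ j) \<psi> m = of_real (energy \<omega> m) ^ j * \<psi> m" for j \<psi>
    by (induction j) (simp_all add: hamiltonian_eq_energy[OF assms] mult.assoc)
  have "gibbs_matrix \<beta> (hamiltonian h S) m n =
      (\<Sum>j. of_real ((- \<beta> * energy \<omega> m) ^ j /\<^sub>R fact j) * ket n m)"
    unfolding gibbs_matrix_def matrix_element_def pow power_mult_distrib
    by (simp add: field_simps)
  also have "\<dots> = of_real (exp (- \<beta> * energy \<omega> m)) * ket n m"
    by (intro sums_unique[symmetric] sums_mult2 sums_of_real exp_converges)
  finally show ?thesis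
    by (simp add: ket_def)
qed

section \<open>Sums over occupation vectors\<close>

text \<open>An occupation vector is an independent choice of one number per mode, so a sum of
  products factors into a product of single-mode sums.\<close>

lemma has_sum_prod_occupation:
  fixes f :: "'n::finite \<Rightarrow> nat \<Rightarrow> real"
  assumes "\<And>k x. f k x \<ge> 0" and "\<And>k. f k sums s k" and "\<And>k. s k > 0"
  shows "((\<lambda>n. \<Prod>k\<in>UNIV. f k (n k)) has_sum (\<Prod>k\<in>UNIV. s k)) UNIV"
proof -
  have hs: "(f k has_sum s k) UNIV" for k
    using assms by (intro sums_nonneg_imp_has_sum) auto
  have "infsum (\<lambda>n. \<Prod>k\<in>UNIV. f k (n k)) (PiE UNIV (\<lambda>_. UNIV)) = (\<Prod>k\<in>UNIV. infsum (f k) UNIV)"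
  proof (rule infsum_prod_PiE_abs)
    fix k
    have "f k summable_on UNIV"
      using hs by (auto simp: summable_on_def)
    then show "(\<lambda>x. norm (f k x)) summable_on UNIV"
      by (simp add: assms(1))
  qed simp
  then have eq: "infsum (\<lambda>n. \<Prod>k\<in>UNIV. f k (n k)) UNIV = (\<Prod>k\<in>UNIV. s k)"
    using infsumI[OF hs] by (simp add: PiE_UNIV_domain)
  \<comment> \<open>The value is nonzero, so it is not the junk value of a divergent sum.\<close>
  moreover have "(\<Prod>k\<in>UNIV. s k) > 0"
    by (simp add: assms(3) prod_pos)
  ultimately have "(\<lambda>n. \<Prod>k\<in>UNIV. f k (n k)) summable_on UNIV"
    by (metis infsum_not_exists less_irrefl)
  with eq show ?thesis
    by (metis has_sum_infsum)
qed

lemma has_sum_finite_sum: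
  fixes f :: "'a \<Rightarrow> 'b \<Rightarrow> 'c::topological_comm_monoid_add"
  assumes "\<And>a. a \<in> I \<Longrightarrow> (f a has_sum s a) B"
  shows "((\<lambda>x. \<Sum>a\<in>I. f a x) has_sum (\<Sum>a\<in>I. s a)) B"
  using assms by (induction I rule: infinite_finite_induct) (auto intro: has_sum_add)

lemma exp_energy: "exp (- \<beta> * energy \<omega> m) = (\<Prod>k\<in>UNIV. exp (- \<beta> * \<omega> k * (real (m k) + 1 / 2)))"
  by (simp add: energy_def sum_distrib_left exp_sum mult.assoc flip: sum_negf)

text \<open>A geometric series and its derivative. The second value is written as the first times
  the mean of n + 1/2, so that the normalization later cancels.\<close>

lemma boltzmann_sums:
  fixes x :: real
  assumes "x > 0"
  shows "(\<lambda>n. exp (- x * (real n + 1 / 2))) sums (1 / (2 * sinh (x / 2)))"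
    and "(\<lambda>n. exp (- x * (real n + 1 / 2)) * (real n + 1 / 2))
           sums (1 / (2 * sinh (x / 2)) * (1 / 2 * coth (x / 2)))"
proof -
  \<comment> \<open>The half-step factor: the zero-point energy contributes one \<open>r\<close>,
    each quantum \<open>r\<^sup>2\<close>, and sinh and cosh of \<open>x / 2\<close> are rational in
    \<open>r\<close>.\<close>
  define r where "r = exp (- x / 2)"
  have r: "0 < r" "r < 1" using assms by (auto simp: r_def)
  then have r2: "norm (r\<^sup>2) < 1"
    by (simp add: power_less_one_iff abs_square_less_1)
  then have r2': "1 - r\<^sup>2 \<noteq> 0" by auto
  have e: "exp (- x * (real n + 1 / 2)) = r * (r\<^sup>2) ^ n" for n
    unfolding r_def by (simp add: algebra_simps flip: exp_of_nat_mult exp_add)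
  have sh: "2 * sinh (x / 2) = (1 - r\<^sup>2) / r"
    using r by (simp add: sinh_field_def r_def exp_minus field_simps power2_eq_square)
  have ch: "2 * cosh (x / 2) = (1 + r\<^sup>2) / r"
    using r by (simp add: cosh_field_def r_def exp_minus field_simps power2_eq_square)
  have ct: "coth (x / 2) = (1 + r\<^sup>2) / (1 - r\<^sup>2)"
  proof -
    have "coth (x / 2) = (2 * cosh (x / 2)) / (2 * sinh (x / 2))" by (simp add: coth_def)
    then show ?thesis unfolding sh ch using r by simp
  qed
  have g: "(\<lambda>n. r * (r\<^sup>2) ^ n) sums (r * (1 / (1 - r\<^sup>2)))"
    by (intro sums_mult geometric_sums r2)
  then show "(\<lambda>n. exp (- x * (real n + 1 / 2))) sums (1 / (2 * sinh (x / 2)))"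
    unfolding e sh by simp
  \<comment> \<open>The derivative series carries n + 1; subtracting half the geometric series gives
    the required n + 1/2.\<close>
  have "(\<lambda>n. real (Suc n) * (r\<^sup>2) ^ n) sums (1 / (1 - r\<^sup>2)\<^sup>2)"
    using geometric_deriv_sums[OF r2] by simp
  then have "(\<lambda>n. r * (real (Suc n) * (r\<^sup>2) ^ n) - r * (r\<^sup>2) ^ n * (1 / 2))
      sums (r * (1 / (1 - r\<^sup>2)\<^sup>2) - r * (1 / (1 - r\<^sup>2)) * (1 / 2))"
    by (intro sums_diff sums_mult sums_mult2 g)
  moreover have "r * (real (Suc n) * (r\<^sup>2) ^ n) - r * (r\<^sup>2) ^ n * (1 / 2)
      = r * (r\<^sup>2) ^ n * (real n + 1 / 2)" for n
    by (simp add: field_simps)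
  moreover have "r * (1 / (1 - r\<^sup>2)\<^sup>2) - r * (1 / (1 - r\<^sup>2)) * (1 / 2)
      = 1 / ((1 - r\<^sup>2) / r) * (1 / 2 * ((1 + r\<^sup>2) / (1 - r\<^sup>2)))"
    using r2' by (simp add: divide_simps) (simp add: power2_eq_square algebra_simps)
  ultimately show "(\<lambda>n. exp (- x * (real n + 1 / 2)) * (real n + 1 / 2))
           sums (1 / (2 * sinh (x / 2)) * (1 / 2 * coth (x / 2)))"
    unfolding e sh ct by simp
qed

lemma gibbs_weight_has_sum:
  assumes "\<beta> > 0" and "\<And>k. \<omega> k > 0"
  shows "((\<lambda>m. exp (- \<beta> * energy \<omega> m)) has_sum (\<Prod>k\<in>UNIV. 1 / (2 * sinh (\<beta> * \<omega> k / 2)))) UNIV"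
  unfolding exp_energy
  by (intro has_sum_prod_occupation) (use assms boltzmann_sums(1)[of "\<beta> * \<omega> _"] in auto)

lemma gibbs_mean_has_sum:
  assumes "\<beta> > 0" and "\<And>k. \<omega> k > 0"
  shows "((\<lambda>m. exp (- \<beta> * energy \<omega> m) * (real (m l) + 1 / 2)) has_sum
      ((\<Prod>k\<in>UNIV. 1 / (2 * sinh (\<beta> * \<omega> k / 2))) * (1 / 2 * coth (\<beta> * \<omega> l / 2)))) UNIV"
proof -
  have pos: "\<beta> * \<omega> k > 0" for k using assms by simp
  \<comment> \<open>The observable concerns mode \<open>l\<close> alone, so it is absorbed into that
    factor and the product structure survives.\<close>
  define f where "f k x = exp (- \<beta> * \<omega> k * (real x + 1 / 2)) * (if k = l then real x + 1 / 2 else 1)" for k x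
  define s where "s k = 1 / (2 * sinh (\<beta> * \<omega> k / 2)) * (if k = l then 1 / 2 * coth (\<beta> * \<omega> k / 2) else 1)" for k
  have "((\<lambda>n. \<Prod>k\<in>UNIV. f k (n k)) has_sum (\<Prod>k\<in>UNIV. s k)) UNIV"
  proof (rule has_sum_prod_occupation)
    show "f k sums s k" for k
      using boltzmann_sums[OF pos[of k]] by (cases "k = l") (simp_all add: f_def[abs_def] s_def)
    show "s k > 0" for k
      using pos[of k] by (auto simp: s_def coth_def intro!: mult_pos_pos divide_pos_pos)
  qed (simp add: f_def)
  moreover have "(\<Prod>k\<in>UNIV. f k (n k)) = exp (- \<beta> * energy \<omega> n) * (real (n l) + 1 / 2)" for n
    unfolding f_def exp_energy prod.distrib by simp
  moreover have "(\<Prod>k\<in>UNIV. s k)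
      = (\<Prod>k\<in>UNIV. 1 / (2 * sinh (\<beta> * \<omega> k / 2))) * (1 / 2 * coth (\<beta> * \<omega> l / 2))"
    unfolding s_def prod.distrib by simp
  ultimately show ?thesis by simp
qed

section \<open>The thermal covariance matrix\<close>

lemma partition_function_eq:
  assumes "\<beta> > 0" and "\<And>k. \<omega> k > 0" and "normal_modes h S \<omega>"
  shows "partition_function \<beta> (hamiltonian h S) = (\<Prod>k\<in>UNIV. 1 / (2 * sinh (\<beta> * \<omega> k / 2)))"
proof -
  have "fock_trace (gibbs_matrix \<beta> (hamiltonian h S)) = of_real (\<Prod>k\<in>UNIV. 1 / (2 * sinh (\<beta> * \<omega> k / 2)))"
    unfolding fock_trace_def gibbs_matrix_eq[OF assms(3)]
    using infsumI[OF has_sum_of_real[OF gibbs_weight_has_sum[of \<beta> \<omega>, OF assms(1,2)]]] by (simp del: of_real_prod)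
  then show ?thesis
    by (simp add: partition_function_def del: of_real_prod)
qed

text \<open>A diagonal state reduces the inner sum to one term, so off-diagonal elements of
  \<open>A\<close> never enter.\<close>

lemma expectation_diagonal:
  fixes \<rho> :: "'n fock_matrix" and p g :: "'n occupation \<Rightarrow> real"
  assumes "\<And>m n. \<rho> m n = (if m = n then of_real (p m) else 0)"
    and "\<And>m. A (ket m) m = of_real (g m)"
    and "((\<lambda>m. p m * g m) has_sum s) UNIV"
  shows "expectation \<rho> A = of_real s"
proof -
  have "(\<Sum>\<^sub>\<infinity>l. \<rho> m l * matrix_element A l m) = of_real (p m * g m)" for m
  proof -
    have "((\<lambda>l. \<rho> m l * matrix_element A l m) has_sum of_real (p m * g m)) UNIV"
      by (rule has_sum_finite_neutralI[of "{m}"]) (auto simp: assms(1,2) matrix_element_def)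
    then show ?thesis by (rule infsumI)
  qed
  then show ?thesis
    unfolding expectation_def fock_trace_def
    using infsumI[OF has_sum_of_real[OF assms(3)]] by simp
qed

text \<open>First moments vanish, and the symmetrized second moments of X are diagonal with equal
  entries for q and p of a mode; \<open>S\<close> acts on both indices.\<close>

lemma covariance_matrix_thermal_state:
  fixes h S :: "('n::finite) phase_matrix"
  assumes "\<beta> > 0" and "\<And>k. \<omega> k > 0" and "normal_modes h S \<omega>"
  shows "covariance_matrix (thermal_state \<beta> (hamiltonian h S)) (quadrature S) =
      S ** mode_diag (\<lambda>k. 1 / 2 * coth (\<beta> * \<omega> k / 2)) ** transpose S"
proof -
  define Z where "Z = (\<Prod>k\<in>UNIV. 1 / (2 * sinh (\<beta> * \<omega> k / 2)))"
  define \<nu> where "\<nu> k = 1 / 2 * coth (\<beta> * \<omega> k / 2)" for k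
  define \<rho> where "\<rho> = thermal_state \<beta> (hamiltonian h S)"
  define p where "p m = exp (- \<beta> * energy \<omega> m) / Z" for m
  have Z: "Z > 0"
    using assms(1,2) by (auto simp: Z_def intro!: prod_pos)
  have \<rho>: "\<rho> m n = (if m = n then of_real (p m) else 0)" for m n
    by (simp add: \<rho>_def thermal_state_def partition_function_eq[OF assms] gibbs_matrix_eq[OF assms(3)]
        p_def Z_def)
  \<comment> \<open>Dividing by \<open>Z\<close> cancels the product of Boltzmann sums and leaves
    the single-mode mean.\<close>
  have mean: "((\<lambda>m. p m * (real (m l) + 1 / 2)) has_sum \<nu> l) UNIV" for l
    using has_sum_cmult_left[OF gibbs_mean_has_sum[of \<beta> \<omega> l, OF assms(1,2)], of "1 / Z"] Z
    by (simp add: p_def \<nu>_def flip: Z_def)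
  have first: "expectation \<rho> (quadrature S i) = 0" for i
    using expectation_diagonal[of \<rho> p "quadrature S i" "\<lambda>_. 0" 0] \<rho>
    by (simp add: quadrature_def normal_quadrature_diag)
  have second: "expectation \<rho> (\<lambda>\<psi> m. (quadrature S i (quadrature S j \<psi>) m + quadrature S j (quadrature S i \<psi>) m) / 2)
      = of_real (\<Sum>a\<in>UNIV. S $ i $ a * S $ j $ a * \<nu> (case_sum id id a))" for i j
  proof (rule expectation_diagonal[OF \<rho>])
    fix m :: "'n occupation"
    define M where "M a b = normal_quadrature a (normal_quadrature b (ket m)) m" for a b
    have M: "M a b + M b a = (if a = b then of_real (2 * real (m (case_sum id id a)) + 1) else 0)" for a b
      unfolding M_def by (rule normal_quadrature_diag_sym)
    \<comment> \<open>Summation indices are exchanged so that both orders share one coefficient and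
      \<open>M a b + M b a\<close> appears.\<close>
    have "quadrature S j (quadrature S i (ket m)) m =
        (\<Sum>b\<in>UNIV. \<Sum>a\<in>UNIV. of_real (S $ j $ b * S $ i $ a) * M b a)"
      by (simp add: quadrature_quadrature M_def)
    also have "\<dots> = (\<Sum>a\<in>UNIV. \<Sum>b\<in>UNIV. of_real (S $ i $ a * S $ j $ b) * M b a)"
      by (subst sum.swap) (simp add: mult_ac)
    finally have "quadrature S i (quadrature S j (ket m)) m + quadrature S j (quadrature S i (ket m)) m
        = (\<Sum>a\<in>UNIV. \<Sum>b\<in>UNIV. of_real (S $ i $ a * S $ j $ b) * (M a b + M b a))"
      by (simp add: quadrature_quadrature M_def sum.distrib ring_distribs)
    also have "\<dots> = (\<Sum>a\<in>UNIV. of_real (S $ i $ a * S $ j $ a) * of_real (2 * real (m (case_sum id id a)) + 1))"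
      unfolding M by (simp add: if_distrib cong: if_cong)
    finally show "(quadrature S i (quadrature S j (ket m)) m + quadrature S j (quadrature S i (ket m)) m) / 2
        = of_real (\<Sum>a\<in>UNIV. S $ i $ a * S $ j $ a * (real (m (case_sum id id a)) + 1 / 2))"
      by (simp add: sum_divide_distrib field_simps)
  next
    have "((\<lambda>m. \<Sum>a\<in>UNIV. S $ i $ a * S $ j $ a * (p m * (real (m (case_sum id id a)) + 1 / 2))) has_sum
        (\<Sum>a\<in>UNIV. S $ i $ a * S $ j $ a * \<nu> (case_sum id id a))) UNIV"
      by (intro has_sum_finite_sum has_sum_cmult_right mean)
    then show "((\<lambda>m. p m * (\<Sum>a\<in>UNIV. S $ i $ a * S $ j $ a * (real (m (case_sum id id a)) + 1 / 2))) has_sum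
        (\<Sum>a\<in>UNIV. S $ i $ a * S $ j $ a * \<nu> (case_sum id id a))) UNIV"
      by (simp only: sum_distrib_left mult.left_commute)
  qed
  have "(S ** mode_diag \<nu> ** transpose S) $ i $ j = (\<Sum>a\<in>UNIV. S $ i $ a * S $ j $ a * \<nu> (case_sum id id a))" for i j
    by (simp add: matrix_matrix_mult_def mode_diag_def transpose_def if_distrib mult_ac cong: if_cong)
  then have "covariance_matrix \<rho> (quadrature S) = S ** mode_diag \<nu> ** transpose S"
    by (simp add: vec_eq_iff covariance_matrix_def first second)
  then show ?thesis
    by (simp add: \<rho>_def \<nu>_def[abs_def])
qed

section \<open>Symplectic eigenvalues\<close>

text \<open>Multiplying the defining relation of \<open>S\<close> by the inverse -J of J exhibits J
  S^T (-J) as a right inverse; for square matrices it is also a left inverse.\<close>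

lemma symplectic_left_inverse:
  fixes S :: "('n::finite) phase_matrix"
  assumes "symplectic S"
  obtains T where "symplectic T" and "T ** S = mat 1"
proof -
  define J :: "'n phase_matrix" where "J = symplectic_form"
  have JJ: "J ** (- J) = mat 1"
  proof -
    have "(J ** (- J)) $ i $ j = mat 1 $ i $ j" for i j
      by (cases i; cases j)
        (simp_all add: J_def matrix_matrix_mult_def symplectic_form_def mat_def sum_UNIV_Plus
          if_distrib[of "\<lambda>x. _ * x"] if_distrib[of "\<lambda>x. - x"] sum_negf cong: if_cong)
    then show ?thesis by (simp add: vec_eq_iff)
  qed
  have S: "S ** J ** transpose S = J"
    using assms by (simp add: symplectic_def J_def)
  define T where "T = J ** transpose S ** (- J)"
  have "S ** T = (S ** J ** transpose S) ** (- J)"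
    by (simp add: T_def matrix_mul_assoc)
  then have "S ** T = mat 1"
    by (simp add: S JJ)
  then have T: "T ** S = mat 1"
    by (simp add: matrix_left_right_inverse)
  then have T': "transpose S ** transpose T = mat 1"
    by (metis matrix_transpose_mul transpose_mat)
  \<comment> \<open>Replacing J by S J S^T lets \<open>T\<close> cancel \<open>S\<close> on both
    sides.\<close>
  have "T ** J ** transpose T = (T ** S) ** J ** (transpose S ** transpose T)"
    by (subst S[symmetric]) (simp add: matrix_mul_assoc)
  then have "symplectic T"
    by (simp add: T T' symplectic_def J_def)
  with T show thesis using that by blast
qed

text \<open>The left inverse of \<open>S\<close> is itself symplectic, so it is the witness that
  undoes the congruence.\<close>

lemma symplectic_eigenvalues_congruence:
  assumes "symplectic S" and "\<And>k. \<nu> k > 0"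
  shows "symplectic_eigenvalues (S ** mode_diag \<nu> ** transpose S) \<nu>"
proof -
  obtain T where T: "symplectic T" "T ** S = mat 1"
    using symplectic_left_inverse[OF assms(1)] .
  have T': "transpose S ** transpose T = mat 1"
    by (metis T(2) matrix_transpose_mul transpose_mat)
  have "T ** (S ** mode_diag \<nu> ** transpose S) ** transpose T
      = (T ** S) ** mode_diag \<nu> ** (transpose S ** transpose T)"
    by (simp add: matrix_mul_assoc)
  then show ?thesis
    using T assms(2) by (auto simp: symplectic_eigenvalues_def T')
qed

text \<open>The expression under the logarithm is 1 / (2 sinh x)^2; the resulting factor -2 cancels
  the prefactor -1/2 of \<open>Phi\<close>.\<close>

lemma ln_coth_square_diff:
  assumes "x > 0"
  shows "ln ((1 / 2 * coth x)\<^sup>2 - 1 / 4) = - 2 * ln (2 * sinh x)"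
proof -
  have s: "sinh x > 0" using assms by simp
  have "(1 / 2 * coth x)\<^sup>2 - 1 / 4 = inverse ((2 * sinh x)\<^sup>2)"
    using s cosh_square_eq[of x] by (simp add: coth_def power_mult_distrib power_divide field_simps)
  then have "ln ((1 / 2 * coth x)\<^sup>2 - 1 / 4) = ln (inverse ((2 * sinh x)\<^sup>2))"
    by (rule arg_cong)
  also have "\<dots> = - 2 * ln (2 * sinh x)"
    using s by (simp only: ln_inverse ln_realpow)
  finally show ?thesis .
qed

text \<open>Both the symplectic spectrum and the product formula for \<open>Z\<close> are
  conclusions drawn from the Fock-space definitions, not assumptions.\<close>

theorem mainTheorem10:
  fixes \<beta> :: real
    and \<omega> \<nu> :: "'n::finite \<Rightarrow> real"
    and h S :: "'n phase_matrix"
    and H :: "'n fock_op"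
    and Z F :: real
  assumes "\<beta> > 0"
    and "\<And>k. \<omega> k > 0"
    and "normal_modes h S \<omega>"
  defines "H \<equiv> hamiltonian h S"
    and "\<nu> \<equiv> \<lambda>k. 1 / 2 * coth (\<beta> * \<omega> k / 2)"
    and "Z \<equiv> partition_function \<beta> H"
    and "F \<equiv> free_energy \<beta> H"
  shows "symplectic_eigenvalues
           (covariance_matrix (thermal_state \<beta> H) (quadrature S)) \<nu>
       \<and> Z = (\<Prod>k\<in>UNIV. 1 / (2 * sinh (\<beta> * \<omega> k / 2)))
       \<and> Phi \<nu> = (\<Sum>k\<in>UNIV. ln (2 * sinh (\<beta> * \<omega> k / 2)))
       \<and> (\<Sum>k\<in>UNIV. ln (2 * sinh (\<beta> * \<omega> k / 2))) = - ln Z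
       \<and> - ln Z = \<beta> * F"
proof (intro conjI)
  have pos: "\<beta> * \<omega> k / 2 > 0" for k using assms(1,2) by simp
  have "\<nu> k > 0" for k
    using pos[of k] by (simp add: \<nu>_def coth_def)
  moreover have "symplectic S"
    using assms(3) by (simp add: normal_modes_def)
  ultimately show "symplectic_eigenvalues (covariance_matrix (thermal_state \<beta> H) (quadrature S)) \<nu>"
    using symplectic_eigenvalues_congruence[of S \<nu>]
    by (simp add: H_def covariance_matrix_thermal_state[OF assms(1-3)] \<nu>_def)
  show Z: "Z = (\<Prod>k\<in>UNIV. 1 / (2 * sinh (\<beta> * \<omega> k / 2)))"
    by (simp only: Z_def H_def partition_function_eq[OF assms(1-3)])
  show "Phi \<nu> = (\<Sum>k\<in>UNIV. ln (2 * sinh (\<beta> * \<omega> k / 2)))"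
    unfolding Phi_def \<nu>_def ln_coth_square_diff[OF pos] by (simp add: sum_negf flip: sum_distrib_left)
  \<comment> \<open>The logarithm splits over the modes because positive frequencies make every
    factor positive.\<close>
  have "ln Z = (\<Sum>k\<in>UNIV. ln (1 / (2 * sinh (\<beta> * \<omega> k / 2))))"
    unfolding Z using assms(1,2) by (intro ln_prod) (auto simp: less_imp_neq[symmetric])
  also have "\<dots> = (\<Sum>k\<in>UNIV. - ln (2 * sinh (\<beta> * \<omega> k / 2)))"
  proof (intro sum.cong refl)
    show "ln (1 / (2 * sinh (\<beta> * \<omega> k / 2))) = - ln (2 * sinh (\<beta> * \<omega> k / 2))" for k
      using pos[of k] ln_inverse[of "2 * sinh (\<beta> * \<omega> k / 2)"] by (simp add: inverse_eq_divide)
  qed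
  finally show "(\<Sum>k\<in>UNIV. ln (2 * sinh (\<beta> * \<omega> k / 2))) = - ln Z"
    by (simp add: sum_negf)
  show "- ln Z = \<beta> * F"
    using assms(1) by (simp add: F_def free_energy_def Z_def)
qed

end
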